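(* Let $H\in(0,1)$ and $T>0$. There exists a constant $C>0$, depending only on $H$ and $T$, such that for every integer $n\ge1$ the following holds. Let $P$ be the covariance matrix of the discretized fractional Gaussian noise on the equi-spaced grid of size $n$ over $[0,T]$ (defined in the context). Then $$\|P^{-1}\|_2\le C n^{\beta},\qquad \beta=\max\{1,2H\},$$ where $\|\cdot\|_2$ denotes the spectral norm.
   Context: A fractional Brownian motion $(B^H_t)_{t\ge0}$ of Hurst index $H\in(0,1)$ is a continuous centred Gaussian process with $\mathbb{E}[B^H_tB^H_s]=\frac12(t^{2H}+s^{2H}-|t-s|^{2H})$. The discretized fractional Gaussian noise on an equi-spaced grid of size $n$ over $[0,T]$ is the vector of increments $(B^H_{(i+1)\delta}-B^H_{i\delta})_{i=0}^{n-1}$ with $\delta=T/n$. Its covariance matrix is the $n\times n$ matrix $P$ with entries $$P_{ij}=\tfrac12\delta^{2H}\left[(|i-j|+1)^{2H}+\big||i-j|-1\big|^{2H}-2|i-j|^{2H}\right].$$ *)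

theory Defs
  imports "HOL-Probability.Probability" "Jordan_Normal_Form.Matrix"
begin

unbundle no vec_syntax
no_notation inner (infix "\<bullet>" 70)

definition vec_l2_norm :: "real Matrix.vec \<Rightarrow> real" where
  "vec_l2_norm v = L2_set (\<lambda>i. v $ i) {..<dim_vec v}"

definition spectral_norm :: "real mat \<Rightarrow> real" where
  "spectral_norm A =
     (SUP v \<in> {v \<in> carrier_vec (dim_col A). vec_l2_norm v \<le> 1}. vec_l2_norm (A *\<^sub>v v))"

text \<open>The supremum above is over a nonempty set that is bounded above, so it is not a junk value.\<close>

lemma spectral_norm_bdd_above:
  "bdd_above ((\<lambda>v. vec_l2_norm (A *\<^sub>v v)) ` {v \<in> carrier_vec (dim_col A). vec_l2_norm v \<le> 1})"
proof (rule bdd_aboveI2)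
  fix v assume v: "v \<in> {v \<in> carrier_vec (dim_col A). vec_l2_norm v \<le> 1}"
  have comp: "\<bar>v $ j\<bar> \<le> 1" if "j < dim_col A" for j
    using member_le_L2_set[of "{..<dim_vec v}" j "\<lambda>i. \<bar>v $ i\<bar>"] v that
    by (auto simp: vec_l2_norm_def L2_set_def intro: order_trans)
  have "vec_l2_norm (A *\<^sub>v v) \<le> (\<Sum>i<dim_row A. \<bar>(A *\<^sub>v v) $ i\<bar>)"
    unfolding vec_l2_norm_def using L2_set_le_sum_abs[of "\<lambda>i. (A *\<^sub>v v) $ i" "{..<dim_row A}"] by simp
  also have "\<dots> \<le> (\<Sum>i<dim_row A. \<Sum>j<dim_col A. \<bar>A $$ (i, j)\<bar>)"
  proof (rule sum_mono)
    fix i assume i: "i \<in> {..<dim_row A}"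
    have "\<bar>(A *\<^sub>v v) $ i\<bar> = \<bar>\<Sum>j<dim_col A. A $$ (i, j) * v $ j\<bar>"
      using i v by (auto simp: scalar_prod_def atLeast0LessThan intro!: arg_cong[where f = abs] sum.cong)
    also have "\<dots> \<le> (\<Sum>j<dim_col A. \<bar>A $$ (i, j) * v $ j\<bar>)"
      by (rule sum_abs)
    also have "\<dots> \<le> (\<Sum>j<dim_col A. \<bar>A $$ (i, j)\<bar>)"
      using comp by (intro sum_mono) (auto simp: abs_mult intro: mult_left_le)
    finally show "\<bar>(A *\<^sub>v v) $ i\<bar> \<le> (\<Sum>j<dim_col A. \<bar>A $$ (i, j)\<bar>)" .
  qed
  finally show "vec_l2_norm (A *\<^sub>v v) \<le> (\<Sum>i<dim_row A. \<Sum>j<dim_col A. \<bar>A $$ (i, j)\<bar>)" .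
qed

text \<open>Rows and columns are indexed by \<open>0, ..., n - 1\<close>. The exponent \<open>2H\<close> is positive, so
  \<open>0 powr (2 * H) = 0\<close> is the intended value of the power at zero.\<close>

definition fgn_cov :: "real \<Rightarrow> real \<Rightarrow> nat \<Rightarrow> real mat" where
  "fgn_cov H T n =
     mat n n (\<lambda>(i, j).
       let \<delta> = T / real n; d = \<bar>real i - real j\<bar>
       in 1 / 2 * \<delta> powr (2 * H) *
          ((d + 1) powr (2 * H) + \<bar>d - 1\<bar> powr (2 * H) - 2 * d powr (2 * H)))"

text \<open>The remaining material shows that \<open>fgn_cov H T n\<close> is the covariance matrix of the
  increments of any fractional Brownian motion. Degenerate Gaussian variables are allowed, since
  linear combinations of a Gaussian process (and the process at time \<open>0\<close>) may vanish
  almost surely.\<close>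

definition centred_gaussian :: "'a measure \<Rightarrow> ('a \<Rightarrow> real) \<Rightarrow> bool" where
  "centred_gaussian M X \<longleftrightarrow>
     X \<in> borel_measurable M \<and>
     ((AE \<omega> in M. X \<omega> = 0) \<or> (\<exists>\<sigma>>0. distributed M lborel X (normal_density 0 \<sigma>)))"

definition centred_gaussian_process ::
  "'a measure \<Rightarrow> 't set \<Rightarrow> ('t \<Rightarrow> 'a \<Rightarrow> real) \<Rightarrow> bool" where
  "centred_gaussian_process M I X \<longleftrightarrow>
     (\<forall>J c. finite J \<and> J \<subseteq> I \<longrightarrow> centred_gaussian M (\<lambda>\<omega>. \<Sum>t\<in>J. c t * X t \<omega>))"

definition fractional_brownian_motion ::
  "'a measure \<Rightarrow> real \<Rightarrow> (real \<Rightarrow> 'a \<Rightarrow> real) \<Rightarrow> bool" where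
  "fractional_brownian_motion M H B \<longleftrightarrow>
     prob_space M \<and> 0 < H \<and> H < 1 \<and>
     centred_gaussian_process M {0..} B \<and>
     (\<forall>\<omega>\<in>space M. continuous_on {0..} (\<lambda>t. B t \<omega>)) \<and>
     (\<forall>s\<ge>0. \<forall>t\<ge>0. integral\<^sup>L M (\<lambda>\<omega>. B t \<omega> * B s \<omega>) =
        1 / 2 * (t powr (2 * H) + s powr (2 * H) - \<bar>t - s\<bar> powr (2 * H)))"

definition fgn :: "(real \<Rightarrow> 'a \<Rightarrow> real) \<Rightarrow> real \<Rightarrow> nat \<Rightarrow> nat \<Rightarrow> 'a \<Rightarrow> real" where
  "fgn B T n i \<omega> = (let \<delta> = T / real n in B ((real i + 1) * \<delta>) \<omega> - B (real i * \<delta>) \<omega>)"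

definition covariance_matrix :: "'a measure \<Rightarrow> nat \<Rightarrow> (nat \<Rightarrow> 'a \<Rightarrow> real) \<Rightarrow> real mat" where
  "covariance_matrix M n X =
     mat n n (\<lambda>(i, j). integral\<^sup>L M (\<lambda>\<omega>.
       (X i \<omega> - integral\<^sup>L M (X i)) * (X j \<omega> - integral\<^sup>L M (X j))))"

lemma centred_gaussian_moments:
  assumes "prob_space M" "centred_gaussian M X"
  shows "integrable M (\<lambda>\<omega>. (X \<omega>)\<^sup>2)" "integral\<^sup>L M X = 0"
proof -
  interpret prob_space M by fact
  have X [measurable]: "X \<in> borel_measurable M"
    using assms(2) by (simp add: centred_gaussian_def)
  have "integrable M (\<lambda>\<omega>. (X \<omega>)\<^sup>2) \<and> integral\<^sup>L M X = 0"
  proof (cases "AE \<omega> in M. X \<omega> = 0")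
    case True
    have "integrable M (\<lambda>\<omega>. (X \<omega>)\<^sup>2) \<longleftrightarrow> integrable M (\<lambda>\<omega>. 0 :: real)"
      using True by (intro integrable_cong_AE) auto
    moreover have "integral\<^sup>L M X = integral\<^sup>L M (\<lambda>\<omega>. 0 :: real)"
      using True by (intro integral_cong_AE) auto
    ultimately show ?thesis by simp
  next
    case False
    then obtain \<sigma> where s: "\<sigma> > 0" and D: "distributed M lborel X (normal_density 0 \<sigma>)"
      using assms(2) by (auto simp: centred_gaussian_def)
    have "integrable M (\<lambda>\<omega>. (X \<omega>)\<^sup>2)"
      using distributed_integrable[OF D, of "\<lambda>x. x\<^sup>2"] integrable_normal_moment[OF s, of 0 2]
      by (simp add: normal_density_nonneg)
    moreover have "integral\<^sup>L M X = 0"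
      using normal_distributed_expectation[OF s D] .
    ultimately show ?thesis ..
  qed
  then show "integrable M (\<lambda>\<omega>. (X \<omega>)\<^sup>2)" "integral\<^sup>L M X = 0" by auto
qed

theorem covariance_matrix_fgn:
  assumes fbm: "fractional_brownian_motion M H B" and T: "T > 0"
  shows "covariance_matrix M n (fgn B T n) = fgn_cov H T n"
proof (rule eq_matI)
  fix i j assume "i < dim_row (fgn_cov H T n)" "j < dim_col (fgn_cov H T n)"
  then have ij: "i < n" "j < n" by (auto simp: fgn_cov_def)
  define \<delta> where "\<delta> = T / real n"
  have \<delta>: "\<delta> > 0" using T ij by (simp add: \<delta>_def)
  interpret prob_space M using fbm by (simp add: fractional_brownian_motion_def)
  have gauss: "centred_gaussian M (B t)" if "t \<ge> 0" for t
  proof -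
    have "centred_gaussian M (\<lambda>\<omega>. \<Sum>s\<in>{t}. 1 * B s \<omega>)"
      using fbm that unfolding fractional_brownian_motion_def centred_gaussian_process_def
      by (elim conjE allE[where x = "{t}"] allE[where x = "\<lambda>_. 1"]) auto
    then show ?thesis by simp
  qed
  have meas [measurable]: "B t \<in> borel_measurable M" if "t \<ge> 0" for t
    using gauss[OF that] by (simp add: centred_gaussian_def)
  have sq: "integrable M (\<lambda>\<omega>. (B t \<omega>)\<^sup>2)" and mean: "integral\<^sup>L M (B t) = 0" if "t \<ge> 0" for t
    using centred_gaussian_moments[OF prob_space_axioms gauss[OF that]] by auto
  have int: "integrable M (B t)" if "t \<ge> 0" for t
    using square_integrable_imp_integrable[OF meas[OF that] sq[OF that]] .
  have int2: "integrable M (\<lambda>\<omega>. B t \<omega> * B s \<omega>)" if "t \<ge> 0" "s \<ge> 0" for s t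
  proof (rule Bochner_Integration.integrable_bound)
    show "integrable M (\<lambda>\<omega>. (B t \<omega>)\<^sup>2 + (B s \<omega>)\<^sup>2)"
      using sq that by auto
    show "(\<lambda>\<omega>. B t \<omega> * B s \<omega>) \<in> borel_measurable M" using that by measurable
    have "\<bar>x * y\<bar> \<le> x\<^sup>2 + y\<^sup>2" for x y :: real
    proof -
      have "2 * (\<bar>x\<bar> * \<bar>y\<bar>) \<le> x\<^sup>2 + y\<^sup>2"
        using sum_squares_bound[of "\<bar>x\<bar>" "\<bar>y\<bar>"] by simp
      moreover have "0 \<le> \<bar>x\<bar> * \<bar>y\<bar>" by simp
      ultimately show ?thesis unfolding abs_mult by linarith
    qed
    then show "AE \<omega> in M. norm (B t \<omega> * B s \<omega>) \<le> norm ((B t \<omega>)\<^sup>2 + (B s \<omega>)\<^sup>2)"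
      by (simp add: order_trans)
  qed
  have cov: "integral\<^sup>L M (\<lambda>\<omega>. B t \<omega> * B s \<omega>) =
      1 / 2 * (t powr (2 * H) + s powr (2 * H) - \<bar>t - s\<bar> powr (2 * H))" if "t \<ge> 0" "s \<ge> 0" for s t
    using fbm that by (simp add: fractional_brownian_motion_def)
  have mean0: "integral\<^sup>L M (fgn B T n k) = 0" for k
    using \<delta> mean int unfolding fgn_def[abs_def] Let_def \<delta>_def[symmetric]
    by (subst Bochner_Integration.integral_diff) auto
  define a b where "a = real i * \<delta>" and "b = real j * \<delta>"
  have ab: "a \<ge> 0" "b \<ge> 0" using \<delta> by (auto simp: a_def b_def)
  have a': "(real i + 1) * \<delta> = a + \<delta>" and b': "(real j + 1) * \<delta> = b + \<delta>"
    by (auto simp: a_def b_def algebra_simps)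
  have "covariance_matrix M n (fgn B T n) $$ (i, j) =
      integral\<^sup>L M (\<lambda>\<omega>. (B (a + \<delta>) \<omega> - B a \<omega>) * (B (b + \<delta>) \<omega> - B b \<omega>))"
    using ij by (simp add: covariance_matrix_def mean0)
      (simp add: fgn_def Let_def \<delta>_def[symmetric] a' b' a_def[symmetric] b_def[symmetric])
  also have "\<dots> = integral\<^sup>L M (\<lambda>\<omega>. (B (a + \<delta>) \<omega> * B (b + \<delta>) \<omega> - B (a + \<delta>) \<omega> * B b \<omega>)
      - (B a \<omega> * B (b + \<delta>) \<omega> - B a \<omega> * B b \<omega>))"
    by (simp add: algebra_simps)
  also have "\<dots> = (integral\<^sup>L M (\<lambda>\<omega>. B (a + \<delta>) \<omega> * B (b + \<delta>) \<omega>)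
      - integral\<^sup>L M (\<lambda>\<omega>. B (a + \<delta>) \<omega> * B b \<omega>))
      - (integral\<^sup>L M (\<lambda>\<omega>. B a \<omega> * B (b + \<delta>) \<omega>) - integral\<^sup>L M (\<lambda>\<omega>. B a \<omega> * B b \<omega>))"
    using ab \<delta> by (simp add: int2)
  also have "\<dots> = 1 / 2 * (\<bar>a - b + \<delta>\<bar> powr (2 * H) + \<bar>a - b - \<delta>\<bar> powr (2 * H)
      - 2 * \<bar>a - b\<bar> powr (2 * H))"
  proof -
    have "\<bar>(a + \<delta>) - b\<bar> = \<bar>a - b + \<delta>\<bar>" "\<bar>a - (b + \<delta>)\<bar> = \<bar>a - b - \<delta>\<bar>"
      "\<bar>(a + \<delta>) - (b + \<delta>)\<bar> = \<bar>a - b\<bar>" by auto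
    then show ?thesis using ab \<delta> by (simp add: cov) (simp add: field_simps)
  qed
  also have "\<bar>a - b + \<delta>\<bar> = \<delta> * \<bar>real i - real j + 1\<bar>"
  proof -
    have "a - b + \<delta> = \<delta> * (real i - real j + 1)" by (simp add: a_def b_def algebra_simps)
    then show ?thesis using \<delta> by (simp add: abs_mult)
  qed
  also have "\<bar>a - b - \<delta>\<bar> = \<delta> * \<bar>real i - real j - 1\<bar>"
  proof -
    have "a - b - \<delta> = \<delta> * (real i - real j - 1)" by (simp add: a_def b_def algebra_simps)
    then show ?thesis using \<delta> by (simp add: abs_mult)
  qed
  also have "\<bar>a - b\<bar> = \<delta> * \<bar>real i - real j\<bar>"
  proof -
    have "a - b = \<delta> * (real i - real j)" by (simp add: a_def b_def algebra_simps)
    then show ?thesis using \<delta> by (simp add: abs_mult)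
  qed
  also have "1 / 2 * ((\<delta> * \<bar>real i - real j + 1\<bar>) powr (2 * H) + (\<delta> * \<bar>real i - real j - 1\<bar>) powr (2 * H)
      - 2 * (\<delta> * \<bar>real i - real j\<bar>) powr (2 * H)) =
    1 / 2 * \<delta> powr (2 * H) * (\<bar>real i - real j + 1\<bar> powr (2 * H) + \<bar>real i - real j - 1\<bar> powr (2 * H)
      - 2 * \<bar>real i - real j\<bar> powr (2 * H))"
    using \<delta> by (simp add: powr_mult algebra_simps)
  also have "\<bar>real i - real j + 1\<bar> powr (2 * H) + \<bar>real i - real j - 1\<bar> powr (2 * H) =
      (\<bar>real i - real j\<bar> + 1) powr (2 * H) + \<bar>\<bar>real i - real j\<bar> - 1\<bar> powr (2 * H)"
  proof (cases "real i \<ge> real j")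
    case True
    then show ?thesis by simp
  next
    case False
    then have "\<bar>real i - real j + 1\<bar> = \<bar>\<bar>real i - real j\<bar> - 1\<bar>"
      "\<bar>real i - real j - 1\<bar> = \<bar>real i - real j\<bar> + 1" by auto
    then show ?thesis by simp
  qed
  finally show "covariance_matrix M n (fgn B T n) $$ (i, j) = fgn_cov H T n $$ (i, j)"
    using ij by (simp add: fgn_cov_def Let_def \<delta>_def)
qed (simp_all add: covariance_matrix_def fgn_cov_def)

end

theory Submission
  imports Defs "Jordan_Normal_Form.Determinant"
begin

text \<open>
  The smallest eigenvalue of the covariance matrix is bounded from below by means of the spectral
  representation of the noise. Substitution shows that the integral of
  \<open>(1 - cos (t * u)) * u powr (- 1 - 2 * H)\<close> over the positive half-line is
  \<open>\<bar>t\<bar> powr (2 * H)\<close> times its value \<open>V\<close> at \<open>t = 1\<close>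
  (\<open>fbm_variogram_scaling\<close>). The covariances of unit-step increments are second differences of
  \<open>\<bar>t\<bar> powr (2 * H)\<close>, so \<open>V\<close> times the covariance at lag \<open>d\<close> is the cosine transform at \<open>d\<close>
  of the density \<open>(1 - cos u) * u powr (- 1 - 2 * H)\<close> (\<open>fgn_autocov_spectral\<close>). Hence the
  quadratic form of a vector \<open>x\<close> is, up to the factor \<open>V\<close>, the integral of
  \<open>\<bar>\<Sum>j. x j * exp (\<i> * j * u)\<bar>\<^sup>2\<close> against this density.

  Since \<open>1 - cos u\<close> is comparable to \<open>u\<^sup>2\<close> on \<open>{0<..pi}\<close>, the density behaves there like
  \<open>u powr (1 - 2 * H)\<close>. For \<open>H \<ge> 1 / 2\<close> this is bounded away from zero. For \<open>H < 1 / 2\<close> it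
  vanishes at the origin, but a trigonometric polynomial with \<open>n\<close> coefficients cannot concentrate
  there: by Cauchy--Schwarz its squared modulus is at most \<open>n * \<parallel>x\<parallel>\<^sup>2\<close>, so the interval
  \<open>{0..1 / n}\<close> carries at most \<open>\<parallel>x\<parallel>\<^sup>2\<close> of the total mass \<open>pi * \<parallel>x\<parallel>\<^sup>2\<close> on \<open>{0..pi}\<close>
  (\<open>integral_energy_spectrum_away_from_0\<close>). On \<open>{1 / n..pi}\<close> the density is at least a constant
  times \<open>n powr (- max 0 (1 - 2 * H))\<close>, which gives \<open>fgn_quadratic_form_ge\<close>.

  The grid scaling contributes the factor \<open>(T / n) powr (2 * H)\<close>, and
  \<open>2 * H + max 0 (1 - 2 * H) = max 1 (2 * H)\<close>. A matrix whose quadratic form is at least \<open>m\<close>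
  times the squared norm is invertible with inverse of norm at most \<open>1 / m\<close>
  (\<open>spectral_norm_inverse_le\<close>).
\<close>

section \<open>Spectral representation of fractional Gaussian noise\<close>

definition fgn_autocov :: "real \<Rightarrow> real \<Rightarrow> real" where
  "fgn_autocov H d = 1 / 2 * (\<bar>d + 1\<bar> powr (2 * H) + \<bar>d - 1\<bar> powr (2 * H) - 2 * \<bar>d\<bar> powr (2 * H))"

text \<open>Up to a constant factor, this is \<open>t \<mapsto> \<bar>t\<bar> powr (2 * H)\<close>, the variance of an increment of
  length \<open>t\<close>, in its spectral form.\<close>

definition fbm_variogram :: "real \<Rightarrow> real \<Rightarrow> real" where
  "fbm_variogram H t = (LINT u:{0<..}|lborel. (1 - cos (t * u)) * u powr (- 1 - 2 * H))"

lemma one_minus_cos_le: "1 - cos u \<le> u\<^sup>2 / (2::real)"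
proof -
  have "1 - cos u = 2 * (sin (u / 2))\<^sup>2"
    using cos_double_sin[of "u / 2"] by simp
  also have "\<dots> \<le> 2 * (u / 2)\<^sup>2"
    using abs_sin_x_le_abs_x[of "u / 2"] by (intro mult_left_mono) (auto simp flip: abs_le_square_iff)
  finally show ?thesis by (simp add: power2_eq_square)
qed

text \<open>Near the origin the integrand is of order \<open>u powr (1 - 2 * H)\<close>, which is integrable because
  \<open>H < 1\<close>; near infinity it is of order \<open>u powr (- 1 - 2 * H)\<close>, which is integrable because
  \<open>0 < H\<close>.\<close>

lemma set_integrable_fbm_variogram:
  fixes H t :: real
  assumes "0 < H" "H < 1"
  shows "set_integrable lborel {0<..} (\<lambda>u. (1 - cos (t * u)) * u powr (- 1 - 2 * H))"
proof -
  have meas: "set_borel_measurable lborel A (\<lambda>u::real. (1 - cos (t * u)) * u powr (- 1 - 2 * H))"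
    if "A \<in> sets borel" for A
    unfolding set_borel_measurable_def using that by measurable
  \<comment> \<open>The bound is \<open>1 - cos (t * u) \<le> (t * u)\<^sup>2 / 2\<close>.\<close>
  have small: "set_integrable lborel {0<..1} (\<lambda>u. (1 - cos (t * u)) * u powr (- 1 - 2 * H))"
  proof (rule set_integrable_bound)
    have "(\<lambda>u. u powr (1 - 2 * H)) integrable_on {0..1}"
      using assms by (intro integrable_on_powr_from_0) auto
    then have "(\<lambda>u. u powr (1 - 2 * H)) absolutely_integrable_on {0..1}"
      by (intro nonnegative_absolutely_integrable_1) auto
    then have "set_integrable lborel {0..1} (\<lambda>u. u powr (1 - 2 * H))"
      unfolding set_integrable_def by (subst (asm) integrable_completion) auto
    then have "set_integrable lborel {0<..1} (\<lambda>u. u powr (1 - 2 * H))"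
      by (rule set_integrable_subset) auto
    then show "set_integrable lborel {0<..1} (\<lambda>u. t\<^sup>2 / 2 * u powr (1 - 2 * H))"
      by (rule set_integrable_mult_right)
    show "set_borel_measurable lborel {0<..1} (\<lambda>u. (1 - cos (t * u)) * u powr (- 1 - 2 * H))"
      by (rule meas) auto
    have "(1 - cos (t * u)) * u powr (- 1 - 2 * H) \<le> t\<^sup>2 / 2 * u powr (1 - 2 * H)" if "u > 0" for u
    proof -
      have "(1 - cos (t * u)) * u powr (- 1 - 2 * H) \<le> ((t * u)\<^sup>2 / 2) * u powr (- 1 - 2 * H)"
        by (intro mult_right_mono one_minus_cos_le) auto
      also have "\<dots> = t\<^sup>2 / 2 * (u powr 2 * u powr (- 1 - 2 * H))"
        using that by (simp add: power_mult_distrib)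
      also have "u powr 2 * u powr (- 1 - 2 * H) = u powr (1 - 2 * H)"
        by (simp flip: powr_add)
      finally show ?thesis .
    qed
    then show "AE u in lborel. u \<in> {0<..1} \<longrightarrow>
        norm ((1 - cos (t * u)) * u powr (- 1 - 2 * H)) \<le> norm (t\<^sup>2 / 2 * u powr (1 - 2 * H))"
      by (auto simp: abs_mult)
  qed
  have large: "set_integrable lborel {1..} (\<lambda>u. (1 - cos (t * u)) * u powr (- 1 - 2 * H))"
  proof (rule set_integrable_bound)
    have "(\<lambda>u. u powr (- 1 - 2 * H)) integrable_on {1..}"
      using has_integral_powr_to_inf[of "- 1 - 2 * H" 1] assms by (auto simp: has_integral_integrable)
    then have "(\<lambda>u. u powr (- 1 - 2 * H)) absolutely_integrable_on {1..}"
      by (intro nonnegative_absolutely_integrable_1) auto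
    then have "set_integrable lborel {1..} (\<lambda>u. u powr (- 1 - 2 * H))"
      unfolding set_integrable_def by (subst (asm) integrable_completion) auto
    then show "set_integrable lborel {1..} (\<lambda>u. 2 * u powr (- 1 - 2 * H))"
      by (rule set_integrable_mult_right)
    show "set_borel_measurable lborel {1..} (\<lambda>u. (1 - cos (t * u)) * u powr (- 1 - 2 * H))"
      by (rule meas) auto
    have "\<bar>1 - cos s\<bar> \<le> (2::real)" for s
      using cos_ge_minus_one[of s] cos_le_one[of s] by linarith
    then show "AE u in lborel. u \<in> {1..} \<longrightarrow>
        norm ((1 - cos (t * u)) * u powr (- 1 - 2 * H)) \<le> norm (2 * u powr (- 1 - 2 * H))"
      by (auto simp: abs_mult intro!: mult_right_mono)
  qed
  have "{0<..1} \<union> {1..} = {0::real<..}" by auto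
  then show ?thesis
    using set_integrable_Un[OF small large] by simp
qed

text \<open>The substitution \<open>u \<mapsto> \<bar>t\<bar> * u\<close> pulls the power of \<open>t\<close> out of the integral.\<close>

lemma fbm_variogram_scaling:
  assumes "0 < H"
  shows "fbm_variogram H t = \<bar>t\<bar> powr (2 * H) * fbm_variogram H 1"
proof (cases "t = 0")
  case True
  then show ?thesis by (simp add: fbm_variogram_def)
next
  case False
  define s where "s = \<bar>t\<bar>"
  have s: "s > 0" using False by (simp add: s_def)
  have "cos (t * u) = cos (s * u)" for u
    by (cases "t \<ge> 0") (auto simp: s_def)
  then have "fbm_variogram H t = fbm_variogram H s"
    by (simp add: fbm_variogram_def)
  also have "\<dots> = s powr (2 * H) * fbm_variogram H 1"
  proof -
    have "fbm_variogram H 1 =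
        s * (\<integral>u. indicator {0<..} (s * u) * ((1 - cos (s * u)) * (s * u) powr (- 1 - 2 * H)) \<partial>lborel)"
      unfolding fbm_variogram_def set_lebesgue_integral_def
      using s by (subst lborel_integral_real_affine[where t = 0 and c = s]) auto
    also have "(\<lambda>u. indicator {0<..} (s * u) * ((1 - cos (s * u)) * (s * u) powr (- 1 - 2 * H)))
        = (\<lambda>u. s powr (- 1 - 2 * H) * (indicator {0<..} u * ((1 - cos (s * u)) * u powr (- 1 - 2 * H))))"
      using s by (auto simp: fun_eq_iff indicator_def zero_less_mult_iff powr_mult)
    also have "s * (\<integral>u. s powr (- 1 - 2 * H) * (indicator {0<..} u * ((1 - cos (s * u)) * u powr (- 1 - 2 * H))) \<partial>lborel)
        = (s powr 1 * s powr (- 1 - 2 * H)) * fbm_variogram H s"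
      using s by (simp add: fbm_variogram_def set_lebesgue_integral_def)
    also have "s powr 1 * s powr (- 1 - 2 * H) = s powr (- (2 * H))"
      using powr_add[of s 1 "- 1 - 2 * H"] by (simp del: powr_one)
    finally show ?thesis
      using s by (simp add: powr_minus field_simps)
  qed
  finally show ?thesis by (simp add: s_def)
qed

text \<open>The autocovariance is a second difference of \<open>\<bar>t\<bar> powr (2 * H)\<close>, and the second difference of
  \<open>1 - cos (t * u)\<close> at \<open>t = d\<close> is \<open>2 * cos (d * u) * (1 - cos u)\<close>.\<close>

lemma
  assumes "0 < H" "H < 1"
  shows set_integrable_fgn_spectral:
      "set_integrable lborel {0<..} (\<lambda>u. cos (d * u) * ((1 - cos u) * u powr (- 1 - 2 * H)))"
    and fgn_autocov_spectral:
      "fgn_autocov H d * fbm_variogram H 1 =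
        (LINT u:{0<..}|lborel. cos (d * u) * ((1 - cos u) * u powr (- 1 - 2 * H)))"
proof -
  define f where "f t u = (1 - cos (t * u)) * u powr (- 1 - 2 * H)" for t u :: real
  have int: "set_integrable lborel {0<..} (f t)" for t
    unfolding f_def by (rule set_integrable_fbm_variogram[OF assms])
  have V: "(LINT u:{0<..}|lborel. f t u) = \<bar>t\<bar> powr (2 * H) * fbm_variogram H 1" for t
    using fbm_variogram_scaling[OF assms(1), of t] by (simp add: fbm_variogram_def f_def)
  have eq: "cos (d * u) * ((1 - cos u) * u powr (- 1 - 2 * H)) =
      1 / 2 * (f (d + 1) u + f (d - 1) u - 2 * f d u)" for u
    by (simp add: f_def ring_distribs cos_add cos_diff)
  show "set_integrable lborel {0<..} (\<lambda>u. cos (d * u) * ((1 - cos u) * u powr (- 1 - 2 * H)))"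
    unfolding eq by (intro set_integrable_mult_right set_integral_diff set_integral_add int)
  have "(LINT u:{0<..}|lborel. 1 / 2 * (f (d + 1) u + f (d - 1) u - 2 * f d u)) =
      1 / 2 * ((LINT u:{0<..}|lborel. f (d + 1) u) + (LINT u:{0<..}|lborel. f (d - 1) u)
        - 2 * (LINT u:{0<..}|lborel. f d u))"
    by (simp add: int)
  then show "fgn_autocov H d * fbm_variogram H 1 =
      (LINT u:{0<..}|lborel. cos (d * u) * ((1 - cos u) * u powr (- 1 - 2 * H)))"
    unfolding eq V by (simp add: fgn_autocov_def algebra_simps)
qed

section \<open>Energy of trigonometric polynomials\<close>

text \<open>The squared modulus of the trigonometric polynomial \<open>\<Sum>j<n. x j * exp (\<i> * j * u)\<close>.\<close>

definition energy_spectrum :: "nat \<Rightarrow> (nat \<Rightarrow> real) \<Rightarrow> real \<Rightarrow> real" where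
  "energy_spectrum n x u = (\<Sum>i<n. x i * cos (real i * u))\<^sup>2 + (\<Sum>i<n. x i * sin (real i * u))\<^sup>2"

lemma energy_spectrum_eq_double_sum:
  "energy_spectrum n x u = (\<Sum>i<n. \<Sum>j<n. x i * x j * cos ((real i - real j) * u))"
proof -
  have "energy_spectrum n x u = (\<Sum>i<n. \<Sum>j<n. (x i * cos (real i * u)) * (x j * cos (real j * u))
      + (x i * sin (real i * u)) * (x j * sin (real j * u)))"
    by (simp add: energy_spectrum_def power2_eq_square sum_product sum.distrib)
  also have "\<dots> = (\<Sum>i<n. \<Sum>j<n. x i * x j * cos ((real i - real j) * u))"
    by (intro sum.cong refl) (simp add: left_diff_distrib cos_diff algebra_simps)
  finally show ?thesis .
qed

lemma energy_spectrum_nonneg: "0 \<le> energy_spectrum n x u"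
  by (simp add: energy_spectrum_def)

lemma continuous_on_energy_spectrum [continuous_intros]: "continuous_on A (energy_spectrum n x)"
  unfolding energy_spectrum_def by (intro continuous_intros)

lemma energy_spectrum_le: "energy_spectrum n x u \<le> real n * (\<Sum>i<n. (x i)\<^sup>2)"
proof -
  have "energy_spectrum n x u \<le> (\<Sum>i<n. (x i)\<^sup>2) * (\<Sum>i<n. (cos (real i * u))\<^sup>2)
      + (\<Sum>i<n. (x i)\<^sup>2) * (\<Sum>i<n. (sin (real i * u))\<^sup>2)"
    unfolding energy_spectrum_def by (intro add_mono Cauchy_Schwarz_ineq_sum)
  also have "\<dots> = (\<Sum>i<n. (x i)\<^sup>2) * (\<Sum>i<n. (cos (real i * u))\<^sup>2 + (sin (real i * u))\<^sup>2)"
    by (simp only: distrib_left sum.distrib)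
  finally show ?thesis by (simp add: mult.commute)
qed

text \<open>Parseval's identity. Integrating over half a period is enough because \<open>cos (k * u)\<close> is even
  and has mean zero over \<open>{0..pi}\<close> for every nonzero integer \<open>k\<close>.\<close>

lemma has_integral_energy_spectrum:
  "(energy_spectrum n x has_integral pi * (\<Sum>i<n. (x i)\<^sup>2)) {0..pi}"
proof -
  have cosint: "((\<lambda>u. cos ((real i - real j) * u)) has_integral (if i = j then pi else 0)) {0..pi}"
    for i j :: nat
  proof (cases "i = j")
    case True
    then show ?thesis using has_integral_const_real[of "1::real" 0 pi] by simp
  next
    case False
    define k where "k = real i - real j"
    have k: "k \<noteq> 0" using False by (simp add: k_def)
    have "((\<lambda>u. cos (k * u)) has_integral sin (k * pi) / k - sin (k * 0) / k) {0..pi}"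
      by (rule fundamental_theorem_of_calculus)
        (use k in \<open>auto intro!: derivative_eq_intros simp flip: has_real_derivative_iff_has_vector_derivative\<close>)
    moreover have "sin (k * pi) = 0"
      by (simp add: k_def left_diff_distrib sin_diff)
    ultimately show ?thesis using False by (simp add: k_def)
  qed
  have "((\<lambda>u. \<Sum>i<n. \<Sum>j<n. x i * x j * cos ((real i - real j) * u)) has_integral
      (\<Sum>i<n. \<Sum>j<n. x i * x j * (if i = j then pi else 0))) {0..pi}"
    by (intro has_integral_sum has_integral_mult_right cosint) auto
  moreover have "(\<Sum>i<n. \<Sum>j<n. x i * x j * (if i = j then pi else 0)) = pi * (\<Sum>i<n. (x i)\<^sup>2)"
    by (simp add: if_distrib[of "(*) _"] sum_distrib_left power2_eq_square mult.commute cong: if_cong)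
  ultimately show ?thesis
    by (simp flip: energy_spectrum_eq_double_sum)
qed

text \<open>The energy is at most \<open>n * (\<Sum>i<n. (x i)\<^sup>2)\<close> everywhere, so an interval of length \<open>1 / n\<close> cannot
  hold more than the share \<open>1 / pi\<close> of the total. The length \<open>1 / n\<close> is the source of the
  factor \<open>n powr (1 - 2 * H)\<close> lost when \<open>H < 1 / 2\<close>.\<close>

lemma integral_energy_spectrum_away_from_0:
  assumes "n \<ge> 1"
  shows "(pi - 1) * (\<Sum>i<n. (x i)\<^sup>2) \<le> integral {1 / real n..pi} (energy_spectrum n x)"
proof -
  have "1 / real n \<le> 1" using assms by simp
  then have n: "0 \<le> 1 / real n" "1 / real n \<le> pi"
    using pi_gt3 by auto
  have int: "energy_spectrum n x integrable_on {a..b}" for a b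
    by (intro integrable_continuous_real continuous_intros)
  have "integral {0..1 / real n} (energy_spectrum n x) + integral {1 / real n..pi} (energy_spectrum n x)
      = integral {0..pi} (energy_spectrum n x)"
    by (rule Henstock_Kurzweil_Integration.integral_combine) (use n int in auto)
  also have "\<dots> = pi * (\<Sum>i<n. (x i)\<^sup>2)"
    using has_integral_energy_spectrum by (rule integral_unique)
  finally have "integral {0..1 / real n} (energy_spectrum n x) + integral {1 / real n..pi} (energy_spectrum n x)
      = pi * (\<Sum>i<n. (x i)\<^sup>2)" .
  moreover have "integral {0..1 / real n} (energy_spectrum n x) \<le> (\<Sum>i<n. (x i)\<^sup>2)"
  proof -
    have "integral {0..1 / real n} (energy_spectrum n x) \<le>
        integral {0..1 / real n} (\<lambda>_. real n * (\<Sum>i<n. (x i)\<^sup>2))"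
      by (intro integral_le int energy_spectrum_le) auto
    then show ?thesis using assms by simp
  qed
  ultimately show ?thesis by (simp add: algebra_simps)
qed

section \<open>Lower bound for the quadratic form\<close>

text \<open>The cubic Taylor bound gives \<open>sin v \<ge> v / 3\<close> on \<open>{0..2}\<close>, an interval that contains
  \<open>{0..pi / 2}\<close>. The constant \<open>18\<close> is not optimal.\<close>

lemma one_minus_cos_ge:
  assumes "0 \<le> u" "u \<le> pi"
  shows "u\<^sup>2 / 18 \<le> 1 - cos u"
proof -
  define v where "v = u / 2"
  have v: "0 \<le> v" "v \<le> 2" using assms pi_less_4 by (auto simp: v_def)
  have "\<bar>sin v - v\<bar> \<le> v ^ 3 / 6"
    using Maclaurin_sin_bound[of v 3] v
    by (simp add: numeral_eq_Suc sin_coeff_def fact_numeral)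
  moreover have "v ^ 3 \<le> 4 * v"
    using mult_mono[of v 2 v 2] v by (simp add: power3_eq_cube mult_right_mono)
  ultimately have "v / 3 \<le> sin v" by linarith
  then have "(v / 3)\<^sup>2 \<le> (sin v)\<^sup>2" using v by (intro power_mono) auto
  moreover have "1 - cos u = 2 * (sin v)\<^sup>2"
    using cos_double_sin[of v] by (simp add: v_def)
  ultimately show ?thesis by (simp add: v_def power2_eq_square)
qed

text \<open>The density is at least \<open>u powr (1 - 2 * H) / 18\<close>, a monotone function of \<open>u\<close>. It is smallest at
  the left end \<open>1 / n\<close> when \<open>H \<le> 1 / 2\<close> and at the right end \<open>pi\<close> otherwise; the product of the two
  powers covers both cases, one of the factors being \<open>1\<close>.\<close>

lemma spectral_density_ge:
  assumes "n \<ge> 1" "1 / real n \<le> u" "u \<le> pi"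
  shows "pi powr (min 0 (1 - 2 * H)) * real n powr (- max 0 (1 - 2 * H)) / 18
    \<le> (1 - cos u) * u powr (- 1 - 2 * H)"
proof -
  have u: "u > 0" using assms by (auto intro: less_le_trans[of _ "1 / real n"])
  have "pi powr (min 0 (1 - 2 * H)) * real n powr (- max 0 (1 - 2 * H)) \<le> u powr (1 - 2 * H)"
  proof (cases "1 - 2 * H \<ge> 0")
    case True
    have "real n powr (- (1 - 2 * H)) = (1 / real n) powr (1 - 2 * H)"
      using powr_minus_divide[of "real n" "1 - 2 * H"] by (simp add: powr_divide)
    also have "\<dots> \<le> u powr (1 - 2 * H)"
      using assms True by (intro powr_mono2) auto
    finally show ?thesis using True by (simp add: min_def max_def)
  next
    case False
    then show ?thesis
      using assms u by (auto simp: min_def max_def intro!: powr_mono2')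
  qed
  also have "u powr (1 - 2 * H) = u powr 2 * u powr (- 1 - 2 * H)"
    by (simp flip: powr_add)
  also have "\<dots> = u\<^sup>2 * u powr (- 1 - 2 * H)"
    using u by simp
  also have "\<dots> \<le> (18 * (1 - cos u)) * u powr (- 1 - 2 * H)"
    using one_minus_cos_ge[of u] u assms by (intro mult_right_mono) auto
  finally show ?thesis by (simp add: algebra_simps)
qed

text \<open>The integrand of the spectral representation is nonnegative, so the integral may be restricted to
  \<open>{1 / n..pi}\<close>, where the density is bounded from below and most of the energy remains.\<close>

lemma fgn_quadratic_form_ge:
  assumes H: "0 < H" "H < 1" and n: "n \<ge> 1"
  shows "pi powr (min 0 (1 - 2 * H)) / 9 * real n powr (- max 0 (1 - 2 * H)) * (\<Sum>i<n. (x i)\<^sup>2)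
    \<le> fbm_variogram H 1 * (\<Sum>i<n. \<Sum>j<n. x i * x j * fgn_autocov H (real i - real j))"
proof -
  define w where "w u = (1 - cos u) * u powr (- 1 - 2 * H)" for u :: real
  define m where "m = pi powr (min 0 (1 - 2 * H)) * real n powr (- max 0 (1 - 2 * H)) / 18"
  have w: "w u \<ge> 0" for u by (simp add: w_def)
  have cint: "set_integrable lborel {0<..} (\<lambda>u. cos (d * u) * w u)" for d
    unfolding w_def by (rule set_integrable_fgn_spectral[OF H])
  have expand: "indicator {0<..} u *\<^sub>R (energy_spectrum n x u * w u) =
      (\<Sum>i<n. \<Sum>j<n. x i * x j * (indicator {0<..} u *\<^sub>R (cos ((real i - real j) * u) * w u)))" for u
    by (simp add: energy_spectrum_eq_double_sum sum_distrib_right sum_distrib_left mult_ac)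
  have int: "set_integrable lborel {0<..} (\<lambda>u. energy_spectrum n x u * w u)"
    unfolding set_integrable_def expand
    by (intro Bochner_Integration.integrable_sum integrable_mult_right cint[unfolded set_integrable_def])
  have "fbm_variogram H 1 * (\<Sum>i<n. \<Sum>j<n. x i * x j * fgn_autocov H (real i - real j)) =
      (\<Sum>i<n. \<Sum>j<n. x i * x j * (fgn_autocov H (real i - real j) * fbm_variogram H 1))"
    by (simp add: sum_distrib_left mult_ac)
  also have "\<dots> = (LINT u:{0<..}|lborel. energy_spectrum n x u * w u)"
    unfolding fgn_autocov_spectral[OF H] w_def[symmetric] set_lebesgue_integral_def expand
    using cint by (simp add: set_integrable_def)
  finally have form: "fbm_variogram H 1 * (\<Sum>i<n. \<Sum>j<n. x i * x j * fgn_autocov H (real i - real j)) =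
    (LINT u:{0<..}|lborel. energy_spectrum n x u * w u)" .
  have sub: "{1 / real n..pi} \<subseteq> {0<..}" 
    using n by (auto intro: less_le_trans[of _ "1 / real n"])
  have eint: "set_integrable lborel {1 / real n..pi} (energy_spectrum n x)"
    by (intro borel_integrable_atLeastAtMost' continuous_intros)
  have "m * ((pi - 1) * (\<Sum>i<n. (x i)\<^sup>2)) \<le> m * integral {1 / real n..pi} (energy_spectrum n x)"
    by (intro mult_left_mono integral_energy_spectrum_away_from_0 n) (simp add: m_def)
  also have "\<dots> = (LINT u:{1 / real n..pi}|lborel. energy_spectrum n x u * m)"
    using set_borel_integral_eq_integral(2)[OF eint] by simp
  also have "\<dots> \<le> (LINT u:{1 / real n..pi}|lborel. energy_spectrum n x u * w u)"
  proof (rule set_integral_mono)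
    show "set_integrable lborel {1 / real n..pi} (\<lambda>u. energy_spectrum n x u * m)"
      using eint by simp
    show "set_integrable lborel {1 / real n..pi} (\<lambda>u. energy_spectrum n x u * w u)"
      by (rule set_integrable_subset[OF int _ sub]) auto
    show "energy_spectrum n x u * m \<le> energy_spectrum n x u * w u" if "u \<in> {1 / real n..pi}" for u
      using spectral_density_ge[of n u H] n that unfolding m_def w_def
      by (intro mult_left_mono energy_spectrum_nonneg) auto
  qed
  also have "\<dots> \<le> (LINT u:{0<..}|lborel. energy_spectrum n x u * w u)"
    unfolding set_lebesgue_integral_def
  proof (rule integral_mono)
    show "integrable lborel (\<lambda>u. indicator {0<..} u *\<^sub>R (energy_spectrum n x u * w u))"
      using int by (simp add: set_integrable_def)
    show "integrable lborel (\<lambda>u. indicator {1 / real n..pi} u *\<^sub>R (energy_spectrum n x u * w u))"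
      using set_integrable_subset[OF int _ sub] by (simp add: set_integrable_def)
  qed (use sub w energy_spectrum_nonneg in \<open>auto simp: indicator_def\<close>)
  finally have "m * ((pi - 1) * (\<Sum>i<n. (x i)\<^sup>2)) \<le>
      fbm_variogram H 1 * (\<Sum>i<n. \<Sum>j<n. x i * x j * fgn_autocov H (real i - real j))"
    unfolding form .
  \<comment> \<open>Replacing \<open>pi - 1\<close> by \<open>2\<close> turns the constant \<open>(pi - 1) / 18\<close> into \<open>1 / 9\<close>.\<close>
  moreover have "m * (2 * (\<Sum>i<n. (x i)\<^sup>2)) \<le> m * ((pi - 1) * (\<Sum>i<n. (x i)\<^sup>2))"
    using pi_gt3 by (intro mult_left_mono mult_right_mono) (auto simp: m_def sum_nonneg)
  moreover have "m * (2 * (\<Sum>i<n. (x i)\<^sup>2)) =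
      pi powr (min 0 (1 - 2 * H)) / 9 * real n powr (- max 0 (1 - 2 * H)) * (\<Sum>i<n. (x i)\<^sup>2)"
    by (simp add: m_def)
  ultimately show ?thesis by linarith
qed

text \<open>The quadratic form bound for the one-point grid already forces the normalizing constant to be
  positive, because the autocovariance at lag zero is \<open>1\<close>.\<close>

lemma fbm_variogram_pos:
  assumes "0 < H" "H < 1"
  shows "0 < fbm_variogram H 1"
proof -
  have "0 < pi powr (min 0 (1 - 2 * H)) / 9" by simp
  also have "\<dots> \<le> fbm_variogram H 1 * fgn_autocov H 0"
    using fgn_quadratic_form_ge[OF assms, of 1 "\<lambda>_. 1"] by simp
  also have "fgn_autocov H 0 = 1" by (simp add: fgn_autocov_def)
  finally show ?thesis by simp
qed

section \<open>Inverses of coercive matrices\<close>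

text \<open>Coercivity makes the kernel trivial, hence the matrix invertible. For \<open>y = Q v\<close> it gives
  \<open>m * \<parallel>y\<parallel>\<^sup>2 \<le> y \<bullet> v \<le> \<parallel>y\<parallel> * \<parallel>v\<parallel>\<close>.\<close>

lemma spectral_norm_inverse_le:
  fixes A :: "real mat"
  assumes A: "A \<in> carrier_mat n n" and m: "m > 0"
    and coercive: "\<And>v. v \<in> carrier_vec n \<Longrightarrow> m * (vec_l2_norm v)\<^sup>2 \<le> v \<bullet> (A *\<^sub>v v)"
  shows "\<exists>Q\<in>carrier_mat n n. inverts_mat A Q \<and> inverts_mat Q A \<and> spectral_norm Q \<le> 1 / m"
proof -
  have norm0: "v = 0\<^sub>v n" if "v \<in> carrier_vec n" "vec_l2_norm v = 0" for v
    using that by (intro eq_vecI) (auto simp: vec_l2_norm_def L2_set_eq_0_iff)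
  have "det A \<noteq> 0"
  proof
    assume "det A = 0"
    then obtain v where v: "v \<in> carrier_vec n" "v \<noteq> 0\<^sub>v n" "A *\<^sub>v v = 0\<^sub>v n"
      using det_0_iff_vec_prod_zero[OF A] by auto
    then have "m * (vec_l2_norm v)\<^sup>2 \<le> 0" using coercive[of v] by simp
    then have "vec_l2_norm v = 0" using m by (simp add: mult_le_0_iff)
    then show False using norm0 v by simp
  qed
  then have "A \<in> Units (ring_mat TYPE(real) n ())"
    by (rule det_non_zero_imp_unit[OF A])
  then obtain Q where Q: "Q \<in> carrier_mat n n" and QA: "Q * A = 1\<^sub>m n" and AQ: "A * Q = 1\<^sub>m n"
    by (auto simp: Units_def ring_mat_def)
  have "vec_l2_norm (Q *\<^sub>v v) \<le> 1 / m" if v: "v \<in> carrier_vec n" "vec_l2_norm v \<le> 1" for v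
  proof -
    define y where "y = Q *\<^sub>v v"
    have y: "y \<in> carrier_vec n" using Q v by (simp add: y_def)
    have Ay: "A *\<^sub>v y = v"
      using assoc_mult_mat_vec[OF A Q v(1)] AQ v by (simp add: y_def)
    have "m * (vec_l2_norm y)\<^sup>2 \<le> y \<bullet> v" using coercive[OF y] Ay by simp
    also have "\<dots> \<le> (\<Sum>i<n. \<bar>y $ i\<bar> * \<bar>v $ i\<bar>)"
      using v y by (auto simp: scalar_prod_def atLeast0LessThan simp flip: abs_mult intro!: sum_mono)
    also have "\<dots> \<le> vec_l2_norm y * vec_l2_norm v"
      using L2_set_mult_ineq[of "\<lambda>i. y $ i" "\<lambda>i. v $ i" "{..<n}"] v y by (simp add: vec_l2_norm_def)
    also have "\<dots> \<le> vec_l2_norm y * 1"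
      using v by (intro mult_left_mono) (auto simp: vec_l2_norm_def L2_set_nonneg)
    finally have "vec_l2_norm y * (m * vec_l2_norm y) \<le> vec_l2_norm y * 1"
      by (simp add: power2_eq_square mult_ac)
    moreover have "vec_l2_norm y \<ge> 0" by (simp add: vec_l2_norm_def L2_set_nonneg)
    ultimately have "m * vec_l2_norm y \<le> 1"
      by (cases "vec_l2_norm y = 0") (auto simp: mult_le_cancel_left)
    then show ?thesis using m by (simp add: y_def field_simps)
  qed
  moreover have "vec_l2_norm (0\<^sub>v n) \<le> 1" by (simp add: vec_l2_norm_def L2_set_def)
  ultimately have "spectral_norm Q \<le> 1 / m"
    unfolding spectral_norm_def using Q by (intro cSUP_least) (auto intro: exI[of _ "0\<^sub>v n"])
  then show ?thesis
    using Q QA AQ A by (auto simp: inverts_mat_def)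
qed

section \<open>The inverse of the covariance matrix\<close>

theorem lemma3p3:
  fixes H T :: real
  assumes "0 < H" and "H < 1" and "0 < T"
  shows "\<exists>C>0. \<forall>n::nat. n \<ge> 1 \<longrightarrow>
    (\<exists>Q\<in>carrier_mat n n.
       inverts_mat (fgn_cov H T n) Q \<and> inverts_mat Q (fgn_cov H T n) \<and>
       spectral_norm Q \<le> C * real n powr (max 1 (2 * H)))"
proof -
  define c where "c = pi powr (min 0 (1 - 2 * H)) / 9"
  define V where "V = fbm_variogram H 1"
  have V: "V > 0" unfolding V_def by (rule fbm_variogram_pos[OF assms(1,2)])
  define C where "C = V / (T powr (2 * H) * c)"
  have "C > 0" using V assms by (simp add: C_def c_def)
  moreover have "\<exists>Q\<in>carrier_mat n n.
       inverts_mat (fgn_cov H T n) Q \<and> inverts_mat Q (fgn_cov H T n) \<and>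
       spectral_norm Q \<le> C * real n powr (max 1 (2 * H))" if n: "n \<ge> 1" for n
  proof -
    define \<delta> where "\<delta> = T / real n"
    define m where "m = \<delta> powr (2 * H) * (c * real n powr (- max 0 (1 - 2 * H)) / V)"
    have \<delta>: "\<delta> > 0" using n assms by (simp add: \<delta>_def)
    have "\<exists>Q\<in>carrier_mat n n. inverts_mat (fgn_cov H T n) Q \<and> inverts_mat Q (fgn_cov H T n) \<and>
        spectral_norm Q \<le> 1 / m"
    proof (rule spectral_norm_inverse_le)
      show "fgn_cov H T n \<in> carrier_mat n n" by (simp add: fgn_cov_def)
      show "m > 0" using n \<delta> V by (simp add: m_def c_def)
      fix v :: "real Matrix.vec" assume v: "v \<in> carrier_vec n"
      define q where "q = (\<Sum>i<n. \<Sum>j<n. v $ i * v $ j * fgn_autocov H (real i - real j))"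
      \<comment> \<open>The autocovariance is even, so its argument may be the signed difference \<open>i - j\<close>.\<close>
      have entry: "fgn_cov H T n $$ (i, j) = \<delta> powr (2 * H) * fgn_autocov H (real i - real j)"
        if "i < n" "j < n" for i j
      proof -
        have "(\<bar>d\<bar> + 1) powr p + \<bar>\<bar>d\<bar> - 1\<bar> powr p = \<bar>d + 1\<bar> powr p + \<bar>d - 1\<bar> powr p" for d p :: real
        proof (cases "d \<ge> 0")
          case False
          then have "\<bar>d + 1\<bar> = \<bar>\<bar>d\<bar> - 1\<bar>" "\<bar>d - 1\<bar> = \<bar>d\<bar> + 1" by auto
          then show ?thesis by simp
        qed simp
        then show ?thesis
          using that by (simp add: fgn_cov_def fgn_autocov_def Let_def \<delta>_def)
      qed
      have dim: "dim_row (fgn_cov H T n) = n" "dim_col (fgn_cov H T n) = n"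
        by (simp_all add: fgn_cov_def)
      have "c * real n powr (- max 0 (1 - 2 * H)) * (\<Sum>i<n. (v $ i)\<^sup>2) \<le> V * q"
        using fgn_quadratic_form_ge[OF assms(1,2) n, of "\<lambda>i. v $ i"]
        by (simp add: c_def V_def q_def)
      then have "c * real n powr (- max 0 (1 - 2 * H)) / V * (\<Sum>i<n. (v $ i)\<^sup>2) \<le> q"
        using V by (simp add: field_simps)
      then have "m * (\<Sum>i<n. (v $ i)\<^sup>2) \<le> \<delta> powr (2 * H) * q"
        unfolding m_def mult.assoc[of "\<delta> powr (2 * H)"] by (rule mult_left_mono) simp
      also have "\<delta> powr (2 * H) * q = v \<bullet> (fgn_cov H T n *\<^sub>v v)"
        using v by (simp add: q_def scalar_prod_def atLeast0LessThan sum_distrib_left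
            entry dim mult_ac)
      also have "(\<Sum>i<n. (v $ i)\<^sup>2) = (vec_l2_norm v)\<^sup>2"
        using v by (simp add: vec_l2_norm_def L2_set_def sum_nonneg)
      finally show "m * (vec_l2_norm v)\<^sup>2 \<le> v \<bullet> (fgn_cov H T n *\<^sub>v v)" .
    qed
    moreover have "1 / m = C * real n powr (max 1 (2 * H))"
    proof -
      have "real n powr (max 1 (2 * H)) = real n powr (2 * H + max 0 (1 - 2 * H))"
        by (simp add: max_def)
      then show ?thesis
        using n assms by (simp add: m_def C_def \<delta>_def powr_divide powr_add powr_minus field_simps)
    qed
    ultimately show ?thesis by simp
  qed
  ultimately show ?thesis by blast
qed

end
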